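(* Let $n\ge 2$, let $X_1,\ldots,X_n$ be independent copies of a real random variable $X$, and let $\mu_1,\ldots,\mu_n$ be distinct positive real numbers. Let $\varphi(t)=E(e^{itX})$, $t\in\mathbb{R}$, be the characteristic function of $X$, and suppose that $\varphi$ is infinitely differentiable at $0$ and that $$\prod_{k=1}^n \varphi(\mu_k t)=\sum_{k=1}^n \theta_k\,\varphi(\mu_k t)\qquad\text{for all } t\in\mathbb{R},$$ where $\theta_k=\prod_{j=1,\,j\neq k}^n \frac{\mu_k^2}{\mu_k^2-\mu_j^2}$ for $k=1,\ldots,n$. Then either $P(X=0)=1$ or $X$ has a Laplace distribution.
   Context: A random variable $X$ has a Laplace (double exponential) distribution if there is $\lambda>0$ such that $P(X>x)=\frac{\lambda}{2}\int_x^\infty e^{-\lambda|y|}\,dy$ for all $x\in\mathbb{R}$; equivalently, its characteristic function is $\frac12\big(\frac{\lambda}{\lambda-it}+\frac{\lambda}{\lambda+it}\big)=\frac{\lambda^2}{\lambda^2+t^2}$. *)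

theory Defs
  imports "HOL-Probability.Probability"
begin

definition infinitely_differentiable_at :: "(real \<Rightarrow> complex) \<Rightarrow> real \<Rightarrow> bool" where
  "infinitely_differentiable_at f a \<longleftrightarrow>
     (\<exists>D :: nat \<Rightarrow> real \<Rightarrow> complex. D 0 = f \<and>
        (\<forall>k. \<exists>e>0. \<forall>t. \<bar>t - a\<bar> < e \<longrightarrow> (D k has_vector_derivative D (Suc k) t) (at t)))"

definition laplace_rv :: "'a measure \<Rightarrow> ('a \<Rightarrow> real) \<Rightarrow> bool" where
  "laplace_rv M X \<longleftrightarrow> (\<exists>l::real. l > 0 \<and>
     (\<forall>x::real. measure M {\<omega> \<in> space M. X \<omega> > x} =
        l / 2 * (LINT y:{x<..}|lborel. exp (- l * \<bar>y\<bar>))))"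

definition theta_coef :: "nat \<Rightarrow> (nat \<Rightarrow> real) \<Rightarrow> nat \<Rightarrow> real" where
  "theta_coef n \<mu> k = (\<Prod>j\<in>{1..n} - {k}. (\<mu> k)\<^sup>2 / ((\<mu> k)\<^sup>2 - (\<mu> j)\<^sup>2))"

end

theory Submission
  imports Defs "HOL-Real_Asymp.Real_Asymp"
begin

text \<open>Smoothness of the characteristic function \<open>\<phi>\<close> at \<open>0\<close> gives moments of all orders. With
  \<open>\<psi>\<close> the characteristic function of a Laplace variable of the same variance, \<open>\<psi>\<close> solves the
  equation by partial fractions. If \<open>\<phi> - \<psi> = c t ^ p + o(t ^ p)\<close>, comparing the terms of order
  \<open>p\<close> yields \<open>c * (\<Sum>k. \<theta> k * \<mu> k ^ p) = c * (\<Sum>k. \<mu> k ^ p)\<close>. The first sum is smaller than the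
  second for \<open>p = 1\<close> and larger for \<open>p \<ge> 3\<close>, so inductively all moments are those of the Laplace
  distribution, which is determined by its moments. In probabilistic terms, the first sum is
  \<open>E (H ^ q) / \<Gamma> (q + 1)\<close>, \<open>q = p / 2\<close>, for \<open>H\<close> a sum of independent exponential variables of means
  \<open>(\<mu> k)\<^sup>2\<close>, and the inequalities express that \<open>x ^ q\<close> is subadditive for \<open>q < 1\<close> and superadditive
  for \<open>q > 1\<close>; a recursion that removes one of the \<open>\<mu> k\<close> proves them without probability.\<close>

section \<open>The partial fraction coefficients\<close>

lemma card2_other:
  assumes "card A \<ge> 2"
  obtains b where "b \<in> A" "b \<noteq> a"
proof -
  have "\<not> A \<subseteq> {a}" using assms card_mono[of "{a}" A] by auto
  then show ?thesis using that by auto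
qed

lemma card2_pair:
  assumes "card A \<ge> 2"
  obtains a b where "a \<in> A" "b \<in> A" "b \<noteq> a"
proof -
  obtain a where "a \<in> A" using assms by fastforce
  with card2_other[OF assms, of a] that show ?thesis by blast
qed

text \<open>This replaces integration over the half-line: \<open>L\<close> plays the role of the
  improper integral of \<open>f\<close>. Since \<open>F\<close> is strictly increasing on the
  half-line, \<open>L \<ge> F 1 > F 0 = 0\<close>; passing through \<open>F 1\<close> keeps the
  inequality strict in the limit.\<close>

lemma limit_pos_of_deriv_pos:
  fixes F f :: "real \<Rightarrow> real"
  assumes "\<And>s. (F has_real_derivative f s) (at s)"
    and "\<And>s. s > 0 \<Longrightarrow> f s > 0" and "F 0 = 0" and "(F \<longlongrightarrow> L) at_top"
  shows "L > 0"
proof -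
  have mono: "F s < F t" if "0 \<le> s" "s < t" for s t
  proof (rule DERIV_pos_imp_increasing_open[OF that(2)])
    show "\<And>x. s < x \<Longrightarrow> x < t \<Longrightarrow> \<exists>y. DERIV F x :> y \<and> y > 0" using assms(1,2) that by force
    show "continuous_on {s..t} F" using assms(1) DERIV_isCont by (blast intro: continuous_at_imp_continuous_on)
  qed
  have "0 < F 1" using mono[of 0 1] assms(3) by simp
  moreover have "F 1 \<le> L"
    using assms(4) by (rule tendsto_lowerbound)
      (auto intro!: eventually_at_top_linorderI[of 1] simp: le_less mono)
  ultimately show ?thesis by simp
qed

locale scales =
  fixes \<mu> :: "'i \<Rightarrow> real" and S :: "'i set"
  assumes finite_S: "finite S"
    and inj_S: "inj_on \<mu> S"
    and pos_S: "\<And>k. k \<in> S \<Longrightarrow> \<mu> k > 0"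
begin

text \<open>The index set is an argument because the inductions remove indices one at a
  time.\<close>

definition theta :: "'i set \<Rightarrow> 'i \<Rightarrow> real" where
  "theta A k = (\<Prod>j\<in>A - {k}. (\<mu> k)\<^sup>2 / ((\<mu> k)\<^sup>2 - (\<mu> j)\<^sup>2))"

text \<open>Exponents are integers because the recursion lowers them by 2, down to -1 and
  -2.\<close>

definition theta_power :: "'i set \<Rightarrow> int \<Rightarrow> real" where
  "theta_power A p = (\<Sum>k\<in>A. theta A k * \<mu> k powi p)"

lemma finite_sub: "A \<subseteq> S \<Longrightarrow> finite A"
  using finite_S finite_subset by blast

lemma squares_neq: "a \<in> S \<Longrightarrow> b \<in> S \<Longrightarrow> a \<noteq> b \<Longrightarrow> (\<mu> a)\<^sup>2 \<noteq> (\<mu> b)\<^sup>2"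
  using inj_S pos_S by (metis inj_onD less_imp_le power2_eq_imp_eq)

lemma theta_remove:
  assumes "A \<subseteq> S" "a \<in> A" "k \<in> A" "k \<noteq> a"
  shows "theta A k * ((\<mu> k)\<^sup>2 - (\<mu> a)\<^sup>2) = theta (A - {a}) k * (\<mu> k)\<^sup>2"
proof -
  have "A - {k} - {a} = A - {a} - {k}" by auto
  then have "theta A k = (\<mu> k)\<^sup>2 / ((\<mu> k)\<^sup>2 - (\<mu> a)\<^sup>2) * theta (A - {a}) k"
    using assms finite_sub[OF assms(1)] unfolding theta_def
    by (subst prod.remove[of "A - {k}" a]) auto
  moreover have "(\<mu> k)\<^sup>2 - (\<mu> a)\<^sup>2 \<noteq> 0" using squares_neq[of k a] assms by auto
  ultimately show ?thesis by simp
qed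

text \<open>The difference of squares vanishes at \<open>k = a\<close> and cancels the denominator
  of index \<open>a\<close> in every other coefficient.\<close>

lemma theta_sum_remove:
  assumes "A \<subseteq> S" "a \<in> A"
  shows "(\<Sum>k\<in>A. theta A k * ((\<mu> k)\<^sup>2 - (\<mu> a)\<^sup>2) * f k) = (\<Sum>k\<in>A - {a}. theta (A - {a}) k * (\<mu> k)\<^sup>2 * f k)"
proof -
  have "(\<Sum>k\<in>A. theta A k * ((\<mu> k)\<^sup>2 - (\<mu> a)\<^sup>2) * f k)
      = (\<Sum>k\<in>A - {a}. theta A k * ((\<mu> k)\<^sup>2 - (\<mu> a)\<^sup>2) * f k)"
    using finite_sub[OF assms(1)] assms by (subst sum.remove[of A a]) auto
  also have "\<dots> = (\<Sum>k\<in>A - {a}. theta (A - {a}) k * (\<mu> k)\<^sup>2 * f k)"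
    using assms theta_remove by (intro sum.cong) auto
  finally show ?thesis .
qed

text \<open>Writing \<open>(\<mu> k)\<^sup>2 = (\<mu> a)\<^sup>2 + ((\<mu> k)\<^sup>2 - (\<mu>
  a)\<^sup>2)\<close> in each term produces the two summands. The comparisons with power sums are
  inductions along this recursion.\<close>

lemma theta_power_rec:
  assumes "A \<subseteq> S" "a \<in> A"
  shows "theta_power A p = (\<mu> a)\<^sup>2 * theta_power A (p - 2) + theta_power (A - {a}) p"
proof -
  have *: "(\<mu> k)\<^sup>2 * \<mu> k powi (p - 2) = \<mu> k powi p" if "k \<in> A" for k
    using pos_S[of k] that assms by (auto simp: power_int_diff)
  have "theta_power A p - (\<mu> a)\<^sup>2 * theta_power A (p - 2)
      = (\<Sum>k\<in>A. theta A k * (\<mu> k)\<^sup>2 * \<mu> k powi (p - 2) - (\<mu> a)\<^sup>2 * (theta A k * \<mu> k powi (p - 2)))"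
    unfolding theta_power_def sum_subtractf sum_distrib_left
    by (intro arg_cong2[of _ _ _ _ minus] sum.cong refl) (auto simp: * mult.assoc)
  also have "\<dots> = (\<Sum>k\<in>A. theta A k * ((\<mu> k)\<^sup>2 - (\<mu> a)\<^sup>2) * \<mu> k powi (p - 2))"
    by (intro sum.cong) (auto simp: algebra_simps)
  also have "\<dots> = theta_power (A - {a}) p"
    unfolding theta_sum_remove[OF assms] theta_power_def
    by (intro sum.cong) (auto simp: * mult.assoc)
  finally show ?thesis by simp
qed

lemma theta_power_singleton [simp]: "theta_power {a} p = \<mu> a powi p"
  by (simp add: theta_power_def theta_def)

text \<open>The step offers the hypothesis for every removed index, so a proof may choose the index
  or compare two removals.\<close>

lemma subset_induct_card [consumes 2, case_names singleton step]:
  assumes "A \<subseteq> S" "A \<noteq> {}"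
    and "\<And>a. a \<in> S \<Longrightarrow> P {a}"
    and "\<And>A. A \<subseteq> S \<Longrightarrow> card A \<ge> 2 \<Longrightarrow> (\<And>a. a \<in> A \<Longrightarrow> P (A - {a})) \<Longrightarrow> P A"
  shows "P A"
proof -
  have "finite A" using finite_sub assms(1) .
  then show ?thesis using assms(1,2)
  proof (induction A rule: finite_psubset_induct)
    case (psubset A)
    show ?case
    proof (cases "card A \<ge> 2")
      case True
      then have ne: "A - {a} \<noteq> {}" for a
        using card_mono[of "{a}" A] by auto
      have "P (A - {a})" if "a \<in> A" for a
      proof (rule psubset(2))
        show "A - {a} \<subset> A" "A - {a} \<subseteq> S" using that psubset(3) by auto
      qed (rule ne)
      then show ?thesis using assms(4)[OF psubset(3) True] by blast
    next
      case False
      moreover have "card A \<noteq> 0" using psubset by auto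
      ultimately have "card A = 1" by linarith
      then obtain a where "A = {a}" using card_1_singletonE by blast
      then show ?thesis using assms(3) psubset by auto
    qed
  qed
qed

text \<open>Removing either of two indices \<open>a\<close> and \<open>b\<close> leaves the same
  value 1, so the recursion makes \<open>theta_power A (-2)\<close> times two different squares
  equal. Hence \<open>theta_power A (-2) = 0\<close>, and only the 1 survives.\<close>

lemma theta_power_0: "A \<subseteq> S \<Longrightarrow> A \<noteq> {} \<Longrightarrow> theta_power A 0 = 1"
proof (induction A rule: subset_induct_card)
  case (step A)
  obtain a b where a: "a \<in> A" and b: "b \<in> A" "b \<noteq> a" using card2_pair[OF step(2)] .
  have *: "theta_power A 0 = (\<mu> c)\<^sup>2 * theta_power A (-2) + 1" if "c \<in> A" for c
    using theta_power_rec[of A c 0] step that by simp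
  have "(\<mu> a)\<^sup>2 * theta_power A (-2) = (\<mu> b)\<^sup>2 * theta_power A (-2)"
    using *[OF a] *[OF b(1)] by linarith
  moreover have "(\<mu> a)\<^sup>2 \<noteq> (\<mu> b)\<^sup>2" using squares_neq[of a b] a b step by auto
  ultimately have "theta_power A (-2) = 0" by simp
  then show ?case using *[OF a] by simp
qed auto

text \<open>Multiplying the sum by the factor of index \<open>a\<close> reduces it to the sum over
  \<open>A - {a}\<close>; the constants left over are values of \<open>theta_power\<close> at 0 and
  cancel.\<close>

lemma partial_fractions:
  assumes "A \<subseteq> S" "A \<noteq> {}" "s \<ge> 0"
  shows "(\<Sum>k\<in>A. theta A k / (1 + (\<mu> k)\<^sup>2 * s)) = (\<Prod>k\<in>A. 1 / (1 + (\<mu> k)\<^sup>2 * s))"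
  using assms(1,2)
proof (induction A rule: subset_induct_card)
  case (step A)
  obtain a b where a: "a \<in> A" and b: "b \<in> A" "b \<noteq> a" using card2_pair[OF step(2)] .
  have pos: "1 + (\<mu> k)\<^sup>2 * s > 0" for k using assms(3) by (simp add: add_pos_nonneg)
  then have nz: "1 + (\<mu> k)\<^sup>2 * s \<noteq> 0" for k by (metis less_irrefl)
  have ne: "A - {a} \<noteq> {}" using card2_other[OF step(2), of a] by blast
  let ?B = "A - {a}"
  let ?P = "\<lambda>A. \<Sum>k\<in>A. theta A k / (1 + (\<mu> k)\<^sup>2 * s)"
  \<comment> \<open>With \<open>d = (\<mu> k)\<^sup>2 - (\<mu> a)\<^sup>2\<close>, the numerator is
    \<open>1 + (\<mu> a)\<^sup>2 * s = (1 + (\<mu> k)\<^sup>2 * s) - d * s\<close>.\<close>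
  have "(1 + (\<mu> a)\<^sup>2 * s) * ?P A
      = (\<Sum>k\<in>A. theta A k - theta A k * ((\<mu> k)\<^sup>2 - (\<mu> a)\<^sup>2) * (s / (1 + (\<mu> k)\<^sup>2 * s)))"
    unfolding sum_distrib_left using nz by (intro sum.cong refl) (simp add: field_simps)
  also have "\<dots> = theta_power A 0 - (\<Sum>k\<in>?B. theta ?B k * (\<mu> k)\<^sup>2 * (s / (1 + (\<mu> k)\<^sup>2 * s)))"
    unfolding sum_subtractf using step(1) a by (subst theta_sum_remove) (auto simp: theta_power_def)
  also have "\<dots> = theta_power A 0 - (\<Sum>k\<in>?B. theta ?B k - theta ?B k / (1 + (\<mu> k)\<^sup>2 * s))"
    using nz by (intro arg_cong2[of _ _ _ _ minus] sum.cong refl) (simp add: field_simps)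
  also have "\<dots> = theta_power A 0 - theta_power ?B 0 + ?P ?B"
    unfolding sum_subtractf by (simp add: theta_power_def)
  also have "\<dots> = ?P ?B"
  proof -
    have "theta_power A 0 = 1" using a by (intro theta_power_0 step(1)) auto
    moreover have "theta_power ?B 0 = 1" using step(1) ne by (intro theta_power_0) auto
    ultimately show ?thesis by simp
  qed
  finally have "?P A = ?P ?B / (1 + (\<mu> a)\<^sup>2 * s)" using nz[of a] by (simp add: field_simps)
  then show ?case using step a finite_sub[OF step(1)] by (simp add: prod.remove[of A a])
qed (auto simp: theta_def)

text \<open>Up to the factor \<open>\<pi> / 2\<close>, \<open>theta_power A (-1)\<close> is the integral over \<open>{0..}\<close> of
  the product of the factors \<open>1 / (1 + (\<mu> k)\<^sup>2 * s\<^sup>2)\<close>, by partial fractions.\<close>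
lemma theta_power_neg1_bounds:
  assumes A: "A \<subseteq> S" and a: "a \<in> A" and b: "b \<in> A" "b \<noteq> a"
  shows "0 < theta_power A (-1)" and "theta_power A (-1) < 1 / \<mu> a"
proof -
  have fin: "finite A" using finite_sub A .
  define F where "F s = (\<Sum>k\<in>A. theta A k * arctan (\<mu> k * s) / \<mu> k)" for s
  define f where "f s = (\<Prod>k\<in>A. 1 / (1 + (\<mu> k)\<^sup>2 * s\<^sup>2))" for s
  have mpos: "\<mu> k > 0" if "k \<in> A" for k using pos_S A that by auto
  have d: "((\<lambda>s. arctan (\<mu> k * s) / \<mu> k) has_real_derivative 1 / (1 + (\<mu> k)\<^sup>2 * s\<^sup>2)) (at s)"
    if "k \<in> A" for k s
    using mpos[OF that] by (auto intro!: derivative_eq_intros simp: power_mult_distrib divide_simps)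
  have dF: "(F has_real_derivative f s) (at s)" for s
  proof -
    have "(F has_real_derivative (\<Sum>k\<in>A. theta A k * (1 / (1 + (\<mu> k)\<^sup>2 * s\<^sup>2)))) (at s)"
      unfolding F_def times_divide_eq_right[symmetric] by (intro DERIV_sum DERIV_cmult d)
    moreover have "(\<Sum>k\<in>A. theta A k / (1 + (\<mu> k)\<^sup>2 * s\<^sup>2)) = f s"
      unfolding f_def using a by (intro partial_fractions A) auto
    ultimately show ?thesis by simp
  qed
  have lim: "((\<lambda>s. arctan (\<mu> k * s) / \<mu> k) \<longlongrightarrow> (pi / 2) * (1 / \<mu> k)) at_top" if "k \<in> A" for k
  proof -
    have "filterlim (\<lambda>s. \<mu> k * s) at_top at_top"
      using mpos[OF that] by (simp add: filterlim_tendsto_pos_mult_at_top[OF tendsto_const] filterlim_ident)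
    then have "((\<lambda>s. arctan (\<mu> k * s)) \<longlongrightarrow> pi / 2) at_top"
      using filterlim_compose[OF tendsto_arctan_at_top] by blast
    from tendsto_divide[OF this tendsto_const, of "\<mu> k"] show ?thesis using mpos[OF that] by simp
  qed
  have limF: "(F \<longlongrightarrow> pi / 2 * theta_power A (-1)) at_top"
  proof -
    have "(F \<longlongrightarrow> (\<Sum>k\<in>A. theta A k * (pi / 2 * (1 / \<mu> k)))) at_top"
      unfolding F_def times_divide_eq_right[symmetric]
      using lim by (intro tendsto_sum tendsto_mult tendsto_const) simp
    then show ?thesis
      by (simp add: theta_power_def sum_distrib_left power_int_minus field_simps)
  qed
  have pos: "1 + (\<mu> k)\<^sup>2 * s\<^sup>2 > 0" for k and s :: real by (simp add: add_pos_nonneg)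
  have fpos: "f s > 0" for s unfolding f_def using pos by (intro prod_pos) auto
  have "pi / 2 * theta_power A (-1) > 0"
    by (rule limit_pos_of_deriv_pos[OF dF fpos _ limF]) (simp add: F_def)
  then show "0 < theta_power A (-1)" by (simp add: zero_less_mult_iff)
  \<comment> \<open>All factors are at most 1, and the factor of index \<open>b\<close> makes the
    comparison with the factor of index \<open>a\<close> strict.\<close>
  have less: "f s < 1 / (1 + (\<mu> a)\<^sup>2 * s\<^sup>2)" if "s > 0" for s
  proof -
    have *: "f s = 1 / (1 + (\<mu> a)\<^sup>2 * s\<^sup>2) * (1 / (1 + (\<mu> b)\<^sup>2 * s\<^sup>2) *
        (\<Prod>k\<in>A - {a} - {b}. 1 / (1 + (\<mu> k)\<^sup>2 * s\<^sup>2)))"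
      unfolding f_def using fin a b by (simp add: prod.remove[of A a] prod.remove[of "A - {a}" b])
    have "(\<Prod>k\<in>A - {a} - {b}. 1 / (1 + (\<mu> k)\<^sup>2 * s\<^sup>2)) \<le> 1"
      using pos by (intro prod_le_1) (auto simp: less_imp_le)
    moreover have "1 / (1 + (\<mu> b)\<^sup>2 * s\<^sup>2) < 1"
      using mpos[OF b(1)] that pos by (simp add: add_pos_pos)
    moreover have "0 < 1 / (1 + (\<mu> b)\<^sup>2 * s\<^sup>2)" using pos by simp
    ultimately have "1 / (1 + (\<mu> b)\<^sup>2 * s\<^sup>2) * (\<Prod>k\<in>A - {a} - {b}. 1 / (1 + (\<mu> k)\<^sup>2 * s\<^sup>2)) < 1"
      by (meson le_less_trans less_imp_le mult_left_le)
    then show ?thesis unfolding * using pos[of a s] by (simp add: divide_simps)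
  qed
  have "pi / 2 * (1 / \<mu> a) - pi / 2 * theta_power A (-1) > 0"
  proof (rule limit_pos_of_deriv_pos)
    show "((\<lambda>s. arctan (\<mu> a * s) / \<mu> a - F s) has_real_derivative
        1 / (1 + (\<mu> a)\<^sup>2 * s\<^sup>2) - f s) (at s)" for s
      by (intro DERIV_diff d a dF)
    show "((\<lambda>s. arctan (\<mu> a * s) / \<mu> a - F s) \<longlongrightarrow> pi / 2 * (1 / \<mu> a) - pi / 2 * theta_power A (-1)) at_top"
      by (intro tendsto_diff lim a limF)
  qed (use less in \<open>auto simp: F_def\<close>)
  then have "0 < pi / 2 * (1 / \<mu> a - theta_power A (-1))" by (simp add: right_diff_distrib)
  then show "theta_power A (-1) < 1 / \<mu> a" by (simp add: zero_less_mult_iff)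
qed

section \<open>Comparison of \<open>theta_power\<close> with power sums\<close>

text \<open>The shift by one lets a natural number index the exponents from -1 on. Exponent -1 is
  the integral bound, exponent 0 gives 1, and from exponent 1 on the recursion adds two positive
  terms: one has a smaller exponent, the other a smaller set.\<close>

lemma theta_power_pos:
  assumes "A \<subseteq> S" "A \<noteq> {}"
  shows "theta_power A (int m - 1) > 0"
  using assms
proof (induction m arbitrary: A rule: less_induct)
  case (less m)
  show ?case using less(2,3)
  proof (induction A rule: subset_induct_card)
    case (step A)
    obtain a b where a: "a \<in> A" and b: "b \<in> A" "b \<noteq> a" using card2_pair[OF step(2)] .
    consider "m = 0" | "m = 1" | "m \<ge> 2" by linarith
    then show ?case
    proof cases
      case 1 then show ?thesis using theta_power_neg1_bounds(1)[OF step(1) a b] by simp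
    next
      case 2
      have "theta_power A 0 = 1" using a by (intro theta_power_0 step(1)) auto
      with 2 show ?thesis by simp
    next
      case 3
      then have "theta_power A (int (m - 2) - 1) > 0" using step(1) a by (intro less(1)) auto
      moreover have "int (m - 2) - 1 = int m - 1 - 2" using 3 by simp
      moreover have "\<mu> a > 0" using pos_S a step(1) by blast
      ultimately show ?thesis
        unfolding theta_power_rec[OF step(1) a, of "int m - 1"] using step(3)[OF a]
        by (simp add: add_pos_pos)
    qed
  qed (use pos_S in auto)
qed

text \<open>Removing an index \<open>b\<close> other than \<open>a\<close> lowers the value by a
  positive multiple of \<open>theta_power A (int m - 2)\<close>, positive because the exponent is at
  least -1. The process ends at \<open>{a}\<close> with equality.\<close>

lemma theta_power_greater_single:
  assumes "A \<subseteq> S" "card A \<ge> 2" "a \<in> A" "m \<ge> 1"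
  shows "theta_power A (int m) > \<mu> a ^ m"
proof -
  have "A \<noteq> {}" using assms by auto
  \<comment> \<open>The weak inequality is carried along because singletons give equality.\<close>
  with assms(1) have "theta_power A (int m) \<ge> \<mu> a ^ m \<and> (card A \<ge> 2 \<longrightarrow> theta_power A (int m) > \<mu> a ^ m)"
    using assms(3)
  proof (induction A rule: subset_induct_card)
    case (step A)
    obtain b where b: "b \<in> A" "b \<noteq> a" using card2_other[OF step(2)] by blast
    have "int (m - 1) - 1 = int m - 2" "A \<noteq> {}" using assms(4) b by auto
    then have "theta_power A (int m - 2) > 0" using theta_power_pos[OF step(1), of "m - 1"] by simp
    moreover have "\<mu> b > 0" using pos_S b step(1) by blast
    ultimately have "theta_power A (int m) > theta_power (A - {b}) (int m)"
      unfolding theta_power_rec[OF step(1) b(1), of "int m"] by simp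
    moreover have "theta_power (A - {b}) (int m) \<ge> \<mu> a ^ m" using step(3)[OF b(1)] step(4) b by blast
    ultimately show ?case by simp
  qed auto
  then show ?thesis using assms(2) by blast
qed

text \<open>The first term of the recursion is less than \<open>\<mu> a\<close> by the upper bound
  at exponent -1, so each removal loses less than the power sum does.\<close>

lemma theta_power_1_less:
  assumes "A \<subseteq> S" "card A \<ge> 2"
  shows "theta_power A 1 < (\<Sum>k\<in>A. \<mu> k)"
proof -
  have ne: "A \<noteq> {}" using assms by auto
  have "theta_power A 1 \<le> (\<Sum>k\<in>A. \<mu> k) \<and> (card A \<ge> 2 \<longrightarrow> theta_power A 1 < (\<Sum>k\<in>A. \<mu> k))"
    using assms(1) ne
  proof (induction A rule: subset_induct_card)
    case (step A)
    obtain a b where a: "a \<in> A" and b: "b \<in> A" "b \<noteq> a" using card2_pair[OF step(2)] .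
    have "\<mu> a > 0" using pos_S a step(1) by blast
    then have "(\<mu> a)\<^sup>2 * theta_power A (-1) < \<mu> a"
      using theta_power_neg1_bounds(2)[OF step(1) a b] by (simp add: field_simps power2_eq_square)
    then show ?case
      using theta_power_rec[OF step(1) a, of 1] step(3)[OF a] finite_sub[OF step(1)] a
      by (simp add: sum.remove[of A a])
  qed auto
  then show ?thesis using assms by blast
qed

text \<open>The first term of the recursion now exceeds \<open>\<mu> a ^ m\<close>. This needs
  \<open>m - 2 \<ge> 1\<close>; at exponent 2 the recursion gives equality of the two sums.\<close>

lemma theta_power_greater:
  assumes "A \<subseteq> S" "card A \<ge> 2" "m \<ge> 3"
  shows "theta_power A (int m) > (\<Sum>k\<in>A. \<mu> k ^ m)"
proof -
  have ne: "A \<noteq> {}" using assms by auto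
  have "theta_power A (int m) \<ge> (\<Sum>k\<in>A. \<mu> k ^ m) \<and>
    (card A \<ge> 2 \<longrightarrow> theta_power A (int m) > (\<Sum>k\<in>A. \<mu> k ^ m))"
    using assms(1) ne
  proof (induction A rule: subset_induct_card)
    case (step A)
    obtain a b where a: "a \<in> A" and b: "b \<in> A" "b \<noteq> a" using card2_pair[OF step(2)] .
    have "\<mu> a > 0" using pos_S a step(1) by blast
    moreover have "theta_power A (int (m - 2)) > \<mu> a ^ (m - 2)"
      using theta_power_greater_single[OF step(1,2) a, of "m - 2"] assms(3) by auto
    ultimately have "(\<mu> a)\<^sup>2 * theta_power A (int (m - 2)) > (\<mu> a)\<^sup>2 * \<mu> a ^ (m - 2)"
      by simp
    moreover have "(\<mu> a)\<^sup>2 * \<mu> a ^ (m - 2) = \<mu> a ^ (2 + (m - 2))" by (simp only: power_add)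
    moreover have "2 + (m - 2) = m" "int (m - 2) = int m - 2" using assms(3) by auto
    ultimately have "(\<mu> a)\<^sup>2 * theta_power A (int m - 2) > \<mu> a ^ m" by metis
    then show ?case
      using theta_power_rec[OF step(1) a, of "int m"] step(3)[OF a] finite_sub[OF step(1)] a
      by (simp add: sum.remove[of A a])
  qed auto
  then show ?thesis using assms by blast
qed

end

section \<open>Existence of moments\<close>

fun fwd_diff :: "real \<Rightarrow> nat \<Rightarrow> (real \<Rightarrow> complex) \<Rightarrow> real \<Rightarrow> complex" where
  "fwd_diff h 0 f t = f t"
| "fwd_diff h (Suc m) f t = fwd_diff h m (\<lambda>s. f (s + h) - f s) t"

text \<open>An iterated mean value inequality. The induction replaces the family \<open>D\<close> of
  derivatives by its differences \<open>E\<close>, which shortens the interval by \<open>h\<close>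
  and turns the bound \<open>B\<close> into \<open>B * h\<close>.\<close>

lemma norm_fwd_diff_le:
  assumes "h > 0" "a \<le> t" "t + real m * h \<le> b"
    and "\<And>j s. j < m \<Longrightarrow> s \<in> {a..b} \<Longrightarrow> (D j has_vector_derivative D (Suc j) s) (at s)"
    and "\<And>s. s \<in> {a..b} \<Longrightarrow> norm (D m s) \<le> B"
  shows "norm (fwd_diff h m (D 0) t) \<le> B * h ^ m"
  using assms
proof (induction m arbitrary: D B b)
  case (Suc m)
  define E where "E j s = D j (s + h) - D j s" for j s
  have mem: "s \<in> {a..b}" "s + h \<in> {a..b}" if "s \<in> {a..b - h}" for s
    using that Suc.prems(1) by auto
  have "norm (fwd_diff h m (E 0) t) \<le> (B * h) * h ^ m"
  proof (rule Suc.IH)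
    show "t + real m * h \<le> b - h" using Suc.prems(3) by (simp add: algebra_simps)
  next
    fix j s assume j: "j < m" and s: "s \<in> {a..b - h}"
    have "((\<lambda>s. s + h) has_vector_derivative 1) (at s)" by (auto intro!: derivative_eq_intros)
    then have "((\<lambda>s. D j (s + h)) has_vector_derivative D (Suc j) (s + h)) (at s)"
      using vector_diff_chain_at[of "\<lambda>s. s + h" 1 s "D j" "D (Suc j) (s + h)"] Suc.prems(4)[of j "s + h"] mem(2)[OF s] j
      by (auto simp: o_def)
    then show "(E j has_vector_derivative E (Suc j) s) (at s)"
      unfolding E_def using Suc.prems(4)[of j s] mem(1)[OF s] j
      by (intro has_vector_derivative_diff) auto
  next
    fix s assume s: "s \<in> {a..b - h}"
    have sub: "{s..s + h} \<subseteq> {a..b}" using s Suc.prems(1) by auto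
    have "norm (D m (s + h) - D m s) \<le> B * norm (s + h - s)"
    proof (rule differentiable_bound[where S = "{s..s + h}" and f' = "\<lambda>x u. u *\<^sub>R D (Suc m) x"])
      show "(D m has_derivative (\<lambda>u. u *\<^sub>R D (Suc m) x)) (at x within {s..s + h})" if "x \<in> {s..s + h}" for x
        using Suc.prems(4)[of m x] sub that has_vector_derivative_at_within
        unfolding has_vector_derivative_def by (auto intro: has_derivative_at_withinI)
      show "onorm (\<lambda>u. u *\<^sub>R D (Suc m) x) \<le> B" if "x \<in> {s..s + h}" for x
        using Suc.prems(5)[of x] sub that
        by (auto intro!: onorm_le simp: mult.commute[of B] mult_left_mono)
    qed (use Suc.prems(1) in auto)
    then show "norm (E m s) \<le> B * h" using Suc.prems(1) by (simp add: E_def)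
  qed (use Suc.prems in auto)
  then show ?case by (simp add: E_def[abs_def] ac_simps)
qed simp

context real_distribution
begin

text \<open>Each difference multiplies the integrand by \<open>iexp (h * x) - 1\<close>; the factor
  \<open>g\<close> is there to absorb it in the induction.\<close>

lemma fwd_diff_char:
  assumes g: "g \<in> borel_measurable borel" and b: "\<And>x. norm (g x :: complex) \<le> K"
  shows "fwd_diff h m (\<lambda>s. CLINT x|M. iexp (s * x) * g x) t
    = (CLINT x|M. iexp (t * x) * (iexp (h * x) - 1) ^ m * g x)"
  using assms
proof (induction m arbitrary: g K)
  case (Suc m)
  note [measurable] = Suc.prems(1)
  have int: "integrable M (\<lambda>x. iexp (s * x) * g x)" for s
    using Suc.prems(2) by (intro integrable_const_bound[of _ K]) (auto simp: norm_mult)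
  have "(CLINT x|M. iexp ((s + h) * x) * g x) - (CLINT x|M. iexp (s * x) * g x)
      = (CLINT x|M. iexp (s * x) * ((iexp (h * x) - 1) * g x))" for s
    by (subst Bochner_Integration.integral_diff[symmetric, OF int int])
      (auto intro!: Bochner_Integration.integral_cong simp: algebra_simps exp_add)
  then have "fwd_diff h (Suc m) (\<lambda>s. CLINT x|M. iexp (s * x) * g x) t
      = fwd_diff h m (\<lambda>s. CLINT x|M. iexp (s * x) * ((iexp (h * x) - 1) * g x)) t"
    by simp
  also have "\<dots> = (CLINT x|M. iexp (t * x) * (iexp (h * x) - 1) ^ m * ((iexp (h * x) - 1) * g x))"
  proof (rule Suc.IH)
    show "norm ((iexp (h * x) - 1) * g x) \<le> 2 * K" for x
      unfolding norm_mult using norm_triangle_ineq4[of "iexp (h * x)" 1] Suc.prems(2)[of x]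
      by (intro mult_mono) auto
  qed measurable
  finally show ?case by (simp add: mult_ac)
qed simp

text \<open>Starting at \<open>- real k * h\<close> centres the difference, and
  \<open>iexp (- (h * x)) * (iexp (h * x) - 1)\<^sup>2\<close> equals
  \<open>-(2 - 2 * cos (h * x))\<close>, a real number of constant sign.\<close>

lemma central_diff_char:
  "fwd_diff h (2 * k) (char M) (- real k * h) = (-1) ^ k * complex_of_real (expectation (\<lambda>x. (2 - 2 * cos (h * x)) ^ k))"
proof -
  have eq: "iexp (- real k * h * x) * (iexp (h * x) - 1) ^ (2 * k)
      = (-1) ^ k * complex_of_real ((2 - 2 * cos (h * x)) ^ k)" for x
  proof -
    have "iexp (- real k * h * x) = iexp (- (h * x)) ^ k"
      by (simp add: exp_of_nat_mult[symmetric] algebra_simps)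
    moreover have "iexp (- (h * x)) * (iexp (h * x) - 1)\<^sup>2 = iexp (h * x) + iexp (- (h * x)) - 2"
      by (simp add: power2_eq_square algebra_simps flip: exp_add)
    moreover have "iexp (h * x) + iexp (- (h * x)) - 2 = - complex_of_real (2 - 2 * cos (h * x))"
      by (auto simp: complex_eq_iff Re_exp Im_exp)
    ultimately show ?thesis
      unfolding power_mult of_real_power by (simp only: power_mult_distrib[symmetric]) simp
  qed
  have "fwd_diff h (2 * k) (char M) (- real k * h)
      = (CLINT x|M. iexp (- real k * h * x) * (iexp (h * x) - 1) ^ (2 * k))"
    using fwd_diff_char[of "\<lambda>_. 1" 1 h "2 * k" "- real k * h"] by (simp add: char_def[abs_def])
  then show ?thesis unfolding eq integral_mult_right_zero integral_complex_of_real .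
qed

text \<open>The central differences of order \<open>2 * k\<close>, divided by
  \<open>h ^ (2 * k)\<close>, stay bounded by the derivative of that order near 0. Their integrands
  are nonnegative and tend to \<open>x ^ (2 * k)\<close>, so Fatou's lemma bounds the
  moment.\<close>

lemma integrable_even_power:
  assumes "infinitely_differentiable_at (char M) 0"
  shows "integrable M (\<lambda>x. x ^ (2 * k))"
proof -
  obtain D where D0: "D 0 = char M"
    and D: "\<And>k. \<exists>e>0. \<forall>t. \<bar>t - 0\<bar> < e \<longrightarrow> (D k has_vector_derivative D (Suc k) t) (at t)"
    using assms unfolding infinitely_differentiable_at_def by metis
  obtain e where e: "\<And>j. e j > 0" "\<And>j t. \<bar>t\<bar> < e j \<Longrightarrow> (D j has_vector_derivative D (Suc j) t) (at t)"
    using D by (metis diff_zero)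
  have "isCont (D (2 * k)) 0"
    using e(2)[of 0 "2 * k"] e(1) by (intro has_vector_derivative_continuous) auto
  then obtain d where d: "d > 0" "\<And>t. \<bar>t\<bar> < d \<Longrightarrow> dist (D (2 * k) t) (D (2 * k) 0) < 1"
    unfolding continuous_at_eps_delta by (metis dist_0_norm dist_commute real_norm_def zero_less_one)
  define B where "B = norm (D (2 * k) 0) + 1"
  have B: "norm (D (2 * k) t) \<le> B" if "\<bar>t\<bar> < d" for t
    using d(2)[OF that] norm_triangle_sub[of "D (2 * k) t" "D (2 * k) 0"]
    unfolding B_def dist_norm by linarith
  \<comment> \<open>Each derivative has its own neighbourhood; halving the minimum of the radii
    makes \<open>r\<close> strictly smaller than all of them.\<close>
  define r where "r = Min (insert d (e ` {..2 * k})) / 2"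
  have r: "r > 0" "r < d" "\<And>j. j \<le> 2 * k \<Longrightarrow> r < e j"
  proof -
    have "Min (insert d (e ` {..2 * k})) > 0" using d e by (subst Min_gr_iff) auto
    moreover have "Min (insert d (e ` {..2 * k})) \<le> d" by (rule Min_le) auto
    moreover have "Min (insert d (e ` {..2 * k})) \<le> e j" if "j \<le> 2 * k" for j
      using that by (intro Min_le) auto
    ultimately show "r > 0" "r < d" "\<And>j. j \<le> 2 * k \<Longrightarrow> r < e j" unfolding r_def by force+
  qed
  have bound: "expectation (\<lambda>x. (2 - 2 * cos (h * x)) ^ k) \<le> B * h ^ (2 * k)"
    if h: "h > 0" "real k * h \<le> r" for h
  proof -
    have "norm (fwd_diff h (2 * k) (D 0) (- real k * h)) \<le> B * h ^ (2 * k)"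
    proof (rule norm_fwd_diff_le[where a = "- r" and b = r])
      show "(D j has_vector_derivative D (Suc j) s) (at s)" if "j < 2 * k" "s \<in> {-r..r}" for j s
        using that r(3)[of j] by (intro e(2)) auto
      show "norm (D (2 * k) s) \<le> B" if "s \<in> {-r..r}" for s
        using that r(2) by (intro B) auto
    qed (use h in \<open>auto simp: mult.commute\<close>)
    then have "\<bar>expectation (\<lambda>x. (2 - 2 * cos (h * x)) ^ k)\<bar> \<le> B * h ^ (2 * k)"
      unfolding D0 central_diff_char by (simp add: norm_mult norm_power del: of_real_power)
    then show ?thesis by linarith
  qed
  \<comment> \<open>The normalised central difference with step
    \<open>h = 1 / real n\<close>.\<close>
  define u where "u n x = ((2 - 2 * cos (1 / real n * x)) * (real n)\<^sup>2) ^ k" for n :: nat and x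
  have u_nonneg: "u n x \<ge> 0" for n x
    unfolding u_def by (intro zero_le_power mult_nonneg_nonneg) (auto simp: cos_le_one)
  have lim: "(\<lambda>n. u n x) \<longlonglongrightarrow> x ^ (2 * k)" for x
  proof -
    have "(\<lambda>n. (2 - 2 * cos (1 / real n * x)) * (real n)\<^sup>2) \<longlonglongrightarrow> x * x"
      by real_asymp
    then show ?thesis unfolding u_def power_mult power2_eq_square[of x] by (intro tendsto_power)
  qed
  have int: "integrable M (\<lambda>x. (2 - 2 * cos (h * x)) ^ k)" for h
  proof (rule integrable_const_bound[of _ "4 ^ k"], intro AE_I2)
    fix x
    have "\<bar>2 - 2 * cos (h * x)\<bar> \<le> 4" using cos_ge_minus_one[of "h * x"] cos_le_one[of "h * x"] by linarith
    then show "norm ((2 - 2 * cos (h * x)) ^ k) \<le> 4 ^ k"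
      by (simp add: power_abs power_mono)
  qed measurable
  have ev: "\<forall>\<^sub>F n in sequentially. (\<integral>\<^sup>+x. ennreal (u n x) \<partial>M) \<le> ennreal B"
  proof -
    obtain N :: nat where N: "real k / r < real N" using reals_Archimedean2 by blast
    show ?thesis
    proof (rule eventually_sequentiallyI)
      fix n assume n: "n \<ge> Suc N"
      have "(\<integral>\<^sup>+x. ennreal (u n x) \<partial>M) = ennreal (expectation (u n))"
        using int[of "1 / real n"] u_nonneg unfolding u_def power_mult_distrib
        by (intro nn_integral_eq_integral) auto
      also have "expectation (u n) = expectation (\<lambda>x. (2 - 2 * cos (1 / real n * x)) ^ k) * (real n) ^ (2 * k)"
        unfolding u_def power_mult_distrib power_mult[symmetric] by simp
      also have "\<dots> \<le> B * (1 / real n) ^ (2 * k) * (real n) ^ (2 * k)"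
      proof (intro mult_right_mono bound)
        have "real k / r < real n" using N n by linarith
        then show "real k * (1 / real n) \<le> r" using r(1) n by (simp add: field_simps)
      qed (use n in auto)
      also have "\<dots> = B" using n by (simp add: power_one_over)
      finally show "(\<integral>\<^sup>+x. ennreal (u n x) \<partial>M) \<le> ennreal B" by (simp add: ennreal_leI)
    qed
  qed
  have "(\<integral>\<^sup>+x. ennreal (x ^ (2 * k)) \<partial>M) = (\<integral>\<^sup>+x. liminf (\<lambda>n. ennreal (u n x)) \<partial>M)"
    by (intro nn_integral_cong lim_imp_Liminf[symmetric] tendsto_ennrealI lim) simp
  also have "\<dots> \<le> liminf (\<lambda>n. \<integral>\<^sup>+x. ennreal (u n x) \<partial>M)"
    by (rule nn_integral_liminf) (simp add: u_def)
  also have "\<dots> \<le> ennreal B"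
    using ev by (intro Liminf_le) auto
  finally have "(\<integral>\<^sup>+x. ennreal (x ^ (2 * k)) \<partial>M) < \<infinity>" using le_less_trans by fastforce
  then show ?thesis
    by (intro integrableI_nonneg) (auto simp: power_mult)
qed

lemma integrable_power_if_even:
  assumes "\<And>k. integrable M (\<lambda>x. x ^ (2 * k))"
  shows "integrable M (\<lambda>x. x ^ k)"
proof (rule Bochner_Integration.integrable_bound)
  show "integrable M (\<lambda>x. 1 + x ^ (2 * k))" using assms by simp
  show "AE x in M. norm (x ^ k) \<le> norm (1 + x ^ (2 * k))"
  proof (rule AE_I2)
    fix x :: real
    have "2 * (\<bar>x ^ k\<bar> * 1) \<le> \<bar>x ^ k\<bar>\<^sup>2 + 1\<^sup>2" using sum_squares_bound[of "\<bar>x ^ k\<bar>" 1] by simp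
    moreover have "\<bar>x ^ k\<bar>\<^sup>2 = x ^ (2 * k)" by (simp add: mult.commute power_mult)
    moreover have "\<bar>x ^ k\<bar> \<ge> 0" by simp
    ultimately have "\<bar>x ^ k\<bar> \<le> 1 + x ^ (2 * k)" by simp
    then show "norm (x ^ k) \<le> norm (1 + x ^ (2 * k))" by simp
  qed
qed measurable

end

section \<open>Solutions of the functional equation\<close>

text \<open>Telescoping, one factor at a time: with all factors tending to 1, the first-order change
  of a product is the sum of the changes of its factors.\<close>

lemma tendsto_prod_diff:
  fixes u v :: "'i \<Rightarrow> 'b \<Rightarrow> 'c :: real_normed_field"
  assumes "finite A"
    and "\<And>k. k \<in> A \<Longrightarrow> (u k \<longlongrightarrow> 1) F" "\<And>k. k \<in> A \<Longrightarrow> (v k \<longlongrightarrow> 1) F"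
    and "\<And>k. k \<in> A \<Longrightarrow> ((\<lambda>t. (u k t - v k t) / w t) \<longlongrightarrow> c k) F"
  shows "((\<lambda>t. ((\<Prod>k\<in>A. u k t) - (\<Prod>k\<in>A. v k t)) / w t) \<longlongrightarrow> (\<Sum>k\<in>A. c k)) F"
  using assms
proof (induction A rule: finite_induct)
  case (insert a A)
  have "((\<lambda>t. (\<Prod>k\<in>A. u k t)) \<longlongrightarrow> (\<Prod>k\<in>A. 1)) F"
    using insert by (intro tendsto_prod) auto
  then have "((\<lambda>t. (u a t - v a t) / w t * (\<Prod>k\<in>A. u k t)
      + v a t * (((\<Prod>k\<in>A. u k t) - (\<Prod>k\<in>A. v k t)) / w t)) \<longlongrightarrow> c a * 1 + 1 * (\<Sum>k\<in>A. c k)) F"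
    using insert by (intro tendsto_add tendsto_mult) auto
  moreover have "(u a t - v a t) / w t * (\<Prod>k\<in>A. u k t)
      + v a t * (((\<Prod>k\<in>A. u k t) - (\<Prod>k\<in>A. v k t)) / w t)
      = ((\<Prod>k\<in>insert a A. u k t) - (\<Prod>k\<in>insert a A. v k t)) / w t" for t
    using insert.hyps by (simp add: algebra_simps diff_divide_distrib add_divide_distrib)
  ultimately show ?case using insert.hyps by simp
qed simp

context scales
begin

definition solution :: "'i set \<Rightarrow> (real \<Rightarrow> complex) \<Rightarrow> bool" where
  "solution A f \<longleftrightarrow> (\<forall>t. (\<Prod>k\<in>A. f (\<mu> k * t)) = (\<Sum>k\<in>A. complex_of_real (theta A k) * f (\<mu> k * t)))"

text \<open>Subtract the two equations and divide by \<open>t ^ p\<close>. Rescaling by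
  \<open>\<mu> k\<close> multiplies the limit \<open>c\<close> by \<open>\<mu> k ^ p\<close>, so the
  product side tends to \<open>c\<close> times the power sum and the other side to \<open>c\<close>
  times \<open>theta_power\<close>.\<close>

lemma solution_difference_order:
  assumes A: "A \<subseteq> S"
    and sol: "solution A f" "solution A g"
    and lim1: "(f \<longlongrightarrow> 1) (at 0)" "(g \<longlongrightarrow> 1) (at 0)"
    and lim: "((\<lambda>t. (f t - g t) / complex_of_real (t ^ p)) \<longlongrightarrow> c) (at 0)"
    and neq: "theta_power A (int p) \<noteq> (\<Sum>k\<in>A. \<mu> k ^ p)"
  shows "c = 0"
proof -
  have fl: "filterlim (\<lambda>t. \<mu> k * t) (at 0) (at 0)" if "k \<in> A" for k
  proof -
    have "\<mu> k \<noteq> 0" using pos_S[of k] A that by auto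
    then show ?thesis
      by (auto simp: filterlim_at eventually_at_filter intro!: tendsto_eq_intros)
  qed
  let ?c = "\<lambda>k. complex_of_real (\<mu> k ^ p) * c"
  have limk: "((\<lambda>t. (f (\<mu> k * t) - g (\<mu> k * t)) / complex_of_real (t ^ p)) \<longlongrightarrow> ?c k) (at 0)"
    if "k \<in> A" for k
  proof -
    have "\<mu> k \<noteq> 0" using pos_S[of k] A that by auto
    then have "complex_of_real (\<mu> k ^ p) * ((f (\<mu> k * t) - g (\<mu> k * t)) / complex_of_real ((\<mu> k * t) ^ p))
        = (f (\<mu> k * t) - g (\<mu> k * t)) / complex_of_real (t ^ p)" for t
      by (simp add: power_mult_distrib)
    with tendsto_mult[OF tendsto_const filterlim_compose[OF lim fl[OF that]], of "complex_of_real (\<mu> k ^ p)"]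
    show ?thesis by simp
  qed
  have "((\<lambda>t. ((\<Prod>k\<in>A. f (\<mu> k * t)) - (\<Prod>k\<in>A. g (\<mu> k * t))) / complex_of_real (t ^ p))
      \<longlongrightarrow> (\<Sum>k\<in>A. ?c k)) (at 0)"
    using filterlim_compose[OF lim1(1) fl] filterlim_compose[OF lim1(2) fl] limk
    by (intro tendsto_prod_diff finite_sub[OF A]) auto
  moreover have "((\<lambda>t. ((\<Prod>k\<in>A. f (\<mu> k * t)) - (\<Prod>k\<in>A. g (\<mu> k * t))) / complex_of_real (t ^ p))
      \<longlongrightarrow> (\<Sum>k\<in>A. complex_of_real (theta A k) * ?c k)) (at 0)"
  proof -
    have "((\<Prod>k\<in>A. f (\<mu> k * t)) - (\<Prod>k\<in>A. g (\<mu> k * t))) / complex_of_real (t ^ p)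
      = (\<Sum>k\<in>A. complex_of_real (theta A k) * ((f (\<mu> k * t) - g (\<mu> k * t)) / complex_of_real (t ^ p)))" for t
      using sol unfolding solution_def
      by (simp add: sum_subtractf sum_divide_distrib right_diff_distrib diff_divide_distrib)
    then show ?thesis by (simp only:) (intro tendsto_sum tendsto_mult tendsto_const limk)
  qed
  ultimately have "(\<Sum>k\<in>A. ?c k) = (\<Sum>k\<in>A. complex_of_real (theta A k) * ?c k)"
    using tendsto_unique[OF at_neq_bot] by blast
  moreover have "complex_of_real (theta_power A (int p) - (\<Sum>k\<in>A. \<mu> k ^ p)) * c
      = (\<Sum>k\<in>A. complex_of_real (theta A k) * ?c k) - (\<Sum>k\<in>A. ?c k)"
    by (simp add: theta_power_def sum_distrib_right left_diff_distrib mult.assoc)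
  ultimately have "complex_of_real (theta_power A (int p) - (\<Sum>k\<in>A. \<mu> k ^ p)) * c = 0" by simp
  with neq show ?thesis by (simp only: mult_eq_0_iff of_real_eq_0_iff right_minus_eq simp_thms)
qed

text \<open>The characteristic function of the zero variable, used as the comparison solution for
  the first moment.\<close>

lemma solution_one:
  assumes "A \<subseteq> S" "A \<noteq> {}"
  shows "solution A (\<lambda>_. 1)"
  using theta_power_0[OF assms] unfolding solution_def theta_power_def
  by (simp flip: of_real_sum)

lemma solution_laplace:
  assumes "A \<subseteq> S" "A \<noteq> {}"
  shows "solution A (\<lambda>t. complex_of_real (1 / (1 + (t / l)\<^sup>2)))"
  unfolding solution_def
proof
  fix t
  have "(\<mu> k * t / l)\<^sup>2 = (\<mu> k)\<^sup>2 * (t / l)\<^sup>2" for k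
    by (simp add: power_mult_distrib power_divide)
  then show "(\<Prod>k\<in>A. complex_of_real (1 / (1 + (\<mu> k * t / l)\<^sup>2)))
      = (\<Sum>k\<in>A. complex_of_real (theta A k) * complex_of_real (1 / (1 + (\<mu> k * t / l)\<^sup>2)))"
    using partial_fractions[OF assms, of "(t / l)\<^sup>2"]
    by (simp only: of_real_prod[symmetric] of_real_mult[symmetric] of_real_sum[symmetric]
        times_divide_eq_right mult_1_right zero_le_power2)
qed

end

section \<open>Taylor expansions of characteristic functions at 0\<close>

text \<open>The average of the moments of an exponential variable and of its reflection.\<close>

definition laplace_moment :: "real \<Rightarrow> nat \<Rightarrow> real" where
  "laplace_moment l j = (1 + (-1) ^ j) / 2 * (fact j / l ^ j)"

text \<open>The Taylor polynomial at 0 of a characteristic function with moments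
  \<open>m\<close>.\<close>

definition taylor_sum :: "(nat \<Rightarrow> real) \<Rightarrow> nat \<Rightarrow> real \<Rightarrow> complex" where
  "taylor_sum m p t = (\<Sum>j\<le>p. (\<i> * complex_of_real t) ^ j / fact j * complex_of_real (m j))"

text \<open>With \<open>z = \<i> * t / l\<close> the function is the mean of
  \<open>1 / (1 - z)\<close> and \<open>1 / (1 + z)\<close>. The Taylor polynomial consists of two
  finite geometric sums, whose remainders have order \<open>p + 1\<close>.\<close>

lemma laplace_taylor:
  assumes "l > 0"
  shows "((\<lambda>t. (complex_of_real (1 / (1 + (t / l)\<^sup>2)) - taylor_sum (laplace_moment l) p t) / complex_of_real (t ^ p)) \<longlongrightarrow> 0) (at 0)"
proof -
  define z where "z t = \<i> * complex_of_real (t / l)" for t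
  have nz: "1 - z t \<noteq> 0" "1 + z t \<noteq> 0" for t
    unfolding z_def by (auto simp: complex_eq_iff)
  have g: "complex_of_real (1 / (1 + (t / l)\<^sup>2)) = (1 / (1 - z t) + 1 / (1 + z t)) / 2" for t
  proof -
    have "(1 - z t) * (1 + z t) = complex_of_real (1 + (t / l)\<^sup>2)"
      unfolding z_def by (simp add: algebra_simps power2_eq_square)
    moreover have "(1 / (1 - z t) + 1 / (1 + z t)) / 2 = 1 / ((1 - z t) * (1 + z t))"
      using nz[of t] by (simp add: divide_simps)
    ultimately show ?thesis by (simp only: of_real_divide of_real_1)
  qed
  have geo: "(\<Sum>j\<le>p. w ^ j) = 1 / (1 - w) - w ^ Suc p / (1 - w)" if "1 - w \<noteq> 0" for w :: complex
    using that sum_gp_basic[of w p] by (simp add: field_simps)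
  have zp: "z t ^ j = (\<i> * complex_of_real t) ^ j / complex_of_real l ^ j" for t j
    by (simp add: z_def power_divide)
  have zm: "(- z t) ^ j = (-1) ^ j * z t ^ j" for t j
    by (rule power_minus)
  have "taylor_sum (laplace_moment l) p t = (\<Sum>j\<le>p. (z t ^ j + (- z t) ^ j) / 2)" for t
    unfolding taylor_sum_def laplace_moment_def zm zp using assms
    by (intro sum.cong refl) (simp add: field_simps)
  also have "\<dots> t = ((\<Sum>j\<le>p. z t ^ j) + (\<Sum>j\<le>p. (- z t) ^ j)) / 2" for t
    by (simp add: sum.distrib flip: sum_divide_distrib)
  also have "\<dots> t = complex_of_real (1 / (1 + (t / l)\<^sup>2)) - (z t ^ Suc p / (1 - z t) + (- z t) ^ Suc p / (1 + z t)) / 2" for t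
  proof -
    have lin: "(a - b + (c - d)) / 2 = (a + c) / 2 - (b + d) / 2" for a b c d :: complex
      by (simp add: field_simps)
    have "(\<Sum>j\<le>p. (- z t) ^ j) = 1 / (1 + z t) - (- z t) ^ Suc p / (1 + z t)"
      using geo[of "- z t"] nz(2)[of t] by simp
    then show ?thesis unfolding g geo[OF nz(1)] by (simp only: lin)
  qed
  finally have eq: "complex_of_real (1 / (1 + (t / l)\<^sup>2)) - taylor_sum (laplace_moment l) p t
      = (z t ^ Suc p / (1 - z t) + (- z t) ^ Suc p / (1 + z t)) / 2" for t by simp
  \<comment> \<open>The remainder with \<open>t ^ p\<close> cancelled: one factor \<open>t\<close>
    is left, so the limit can be read off by continuity.\<close>
  let ?h = "\<lambda>t. (complex_of_real t * (\<i> / l) ^ Suc p / (1 - z t) + complex_of_real t * ((-1) ^ Suc p * (\<i> / l) ^ Suc p) / (1 + z t)) / 2"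
  have "(?h \<longlongrightarrow> (complex_of_real 0 * (\<i> / l) ^ Suc p / (1 - z 0) + complex_of_real 0 * ((-1) ^ Suc p * (\<i> / l) ^ Suc p) / (1 + z 0)) / 2) (at 0)"
    using nz[of 0] assms unfolding z_def by (intro tendsto_intros) auto
  then have "(?h \<longlongrightarrow> 0) (at 0)" by simp
  moreover have "\<forall>\<^sub>F t in at 0. ?h t = (complex_of_real (1 / (1 + (t / l)\<^sup>2)) - taylor_sum (laplace_moment l) p t) / complex_of_real (t ^ p)"
  proof (rule eventually_at_filter[THEN iffD2], rule always_eventually, intro allI impI)
    fix t :: real assume t: "t \<noteq> 0"
    have lin: "(a / b + c / d) / 2 / w = (a / w / b + c / w / d) / 2" for a b c d w :: complex
      by (simp add: add_divide_distrib mult_ac)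
    have "z t ^ Suc p / complex_of_real (t ^ p) = complex_of_real t * (\<i> / l) ^ Suc p"
      "(- z t) ^ Suc p / complex_of_real (t ^ p) = complex_of_real t * ((-1) ^ Suc p * (\<i> / l) ^ Suc p)"
      using t unfolding zm zp by (simp_all add: power_mult_distrib power_divide)
    then show "?h t = (complex_of_real (1 / (1 + (t / l)\<^sup>2)) - taylor_sum (laplace_moment l) p t) / complex_of_real (t ^ p)"
      unfolding eq lin by (simp only:)
  qed
  ultimately show ?thesis by (rule Lim_transform_eventually)
qed

context real_distribution
begin

text \<open>The bound of \<open>char_approx1\<close> for degree \<open>p\<close> is only of order
  \<open>t ^ p\<close>. Expanding to degree \<open>p + 1\<close> and moving the last term into the
  error gains the missing power of \<open>t\<close>.\<close>

lemma char_taylor: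
  assumes "\<And>k. integrable M (\<lambda>x. x ^ k)"
  shows "((\<lambda>t. (char M t - taylor_sum (\<lambda>j. expectation (\<lambda>x. x ^ j)) p t) / complex_of_real (t ^ p)) \<longlongrightarrow> 0) (at 0)"
proof -
  let ?m = "\<lambda>j. expectation (\<lambda>x. x ^ j)"
  define C where "C = 2 / fact (Suc p) * expectation (\<lambda>x. \<bar>x\<bar> ^ Suc p) + norm (\<i> ^ Suc p / fact (Suc p) * complex_of_real (?m (Suc p)))"
  have "norm (char M t - taylor_sum ?m p t) \<le> C * \<bar>t\<bar> ^ Suc p" for t
  proof -
    have "taylor_sum ?m p t = taylor_sum ?m (Suc p) t - (\<i> * t) ^ Suc p / fact (Suc p) * complex_of_real (?m (Suc p))"
      unfolding taylor_sum_def by (simp del: fact_Suc)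
    then have "char M t - taylor_sum ?m p t = (char M t - taylor_sum ?m (Suc p) t)
        + (\<i> * t) ^ Suc p / fact (Suc p) * complex_of_real (?m (Suc p))"
      by (simp only: diff_diff_eq2 diff_add_eq)
    then have "norm (char M t - taylor_sum ?m p t) \<le> norm (char M t - taylor_sum ?m (Suc p) t)
        + norm ((\<i> * t) ^ Suc p / fact (Suc p) * complex_of_real (?m (Suc p)))"
      by (simp only: norm_triangle_ineq)
    also have "norm (char M t - taylor_sum ?m (Suc p) t) \<le> 2 * \<bar>t\<bar> ^ Suc p / fact (Suc p) * expectation (\<lambda>x. \<bar>x\<bar> ^ Suc p)"
      using char_approx1[of "Suc p" t] assms unfolding taylor_sum_def by simp
    finally show ?thesis
      unfolding C_def by (simp add: norm_mult norm_power norm_divide power_mult_distrib algebra_simps del: fact_Suc power_Suc)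
  qed
  then have le: "norm ((char M t - taylor_sum ?m p t) / complex_of_real (t ^ p)) \<le> C * \<bar>t\<bar>" if "t \<noteq> 0" for t
    using that by (simp add: norm_divide norm_power divide_simps mult_ac)
  show ?thesis
  proof (rule Lim_null_comparison)
    show "\<forall>\<^sub>F t in at 0. norm ((char M t - taylor_sum ?m p t) / complex_of_real (t ^ p)) \<le> C * \<bar>t\<bar>"
      unfolding eventually_at_filter using le by (intro always_eventually) blast
    show "((\<lambda>t. C * \<bar>t\<bar>) \<longlongrightarrow> 0) (at 0)"
      by (rule tendsto_eq_intros refl | simp)+
  qed
qed

end

section \<open>Determining the moments from the equation\<close>

text \<open>The Taylor terms below order \<open>p\<close> agree, so \<open>char M - g\<close> is
  \<open>?d * t ^ p\<close> up to \<open>o(t ^ p)\<close>, where \<open>?d\<close> is a nonzero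
  multiple of the difference of the moments of order \<open>p\<close>.
  \<open>solution_difference_order\<close> forces \<open>?d = 0\<close>.\<close>

lemma (in scales) moment_eq_of_lower:
  assumes M: "real_distribution M" and int: "\<And>k. integrable M (\<lambda>x. x ^ k)"
    and A: "A \<subseteq> S" and sol: "solution A (char M)" "solution A g"
    and g1: "(g \<longlongrightarrow> 1) (at 0)"
    and gm: "((\<lambda>t. (g t - taylor_sum m p t) / complex_of_real (t ^ p)) \<longlongrightarrow> 0) (at 0)"
    and neq: "theta_power A (int p) \<noteq> (\<Sum>k\<in>A. \<mu> k ^ p)"
    and lower: "\<And>j. j < p \<Longrightarrow> (\<integral>x. x ^ j \<partial>M) = m j"
  shows "(\<integral>x. x ^ p \<partial>M) = m p"
proof -
  interpret real_distribution M by fact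
  let ?e = "\<lambda>j. expectation (\<lambda>x. x ^ j)"
  let ?d = "\<i> ^ p / fact p * complex_of_real (?e p - m p)"
  have "taylor_sum ?e p t - taylor_sum m p t = complex_of_real (t ^ p) * ?d" for t
  proof -
    have "taylor_sum ?e p t - taylor_sum m p t
        = (\<Sum>j\<le>p. (\<i> * complex_of_real t) ^ j / fact j * complex_of_real (?e j - m j))"
      unfolding taylor_sum_def sum_subtractf[symmetric] of_real_diff right_diff_distrib ..
    also have "\<dots> = (\<Sum>j\<in>{p}. (\<i> * complex_of_real t) ^ j / fact j * complex_of_real (?e j - m j))"
      using lower by (intro sum.mono_neutral_right) auto
    finally show ?thesis by (simp add: power_mult_distrib)
  qed
  then have wd: "complex_of_real (t ^ p) * ?d = taylor_sum ?e p t - taylor_sum m p t" for t ..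
  have *: "(char M t - taylor_sum ?e p t) / complex_of_real (t ^ p) - (g t - taylor_sum m p t) / complex_of_real (t ^ p) + ?d
      = (char M t - g t) / complex_of_real (t ^ p)" if "t \<noteq> 0" for t
  proof -
    have alg: "(a - b) / w - (c - d) / w + e = (a - c) / w" if "w \<noteq> 0" "w * e = b - d"
      for a b c d e w :: complex
    proof -
      have "e = (b - d) / w" using that by (simp add: field_simps)
      then show ?thesis by (simp add: diff_divide_distrib)
    qed
    show ?thesis using that by (intro alg wd) simp
  qed
  have "((\<lambda>t. (char M t - taylor_sum ?e p t) / complex_of_real (t ^ p) - (g t - taylor_sum m p t) / complex_of_real (t ^ p) + ?d)
      \<longlongrightarrow> 0 - 0 + ?d) (at 0)"
    by (intro tendsto_add tendsto_diff char_taylor int gm tendsto_const)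
  then have "((\<lambda>t. (char M t - g t) / complex_of_real (t ^ p)) \<longlongrightarrow> 0 - 0 + ?d) (at 0)"
    by (rule Lim_transform_eventually) (use * in \<open>auto simp only: eventually_at_filter intro!: always_eventually\<close>)
  moreover have "(char M \<longlongrightarrow> 1) (at 0)"
    using isCont_char[of 0] char_zero by (simp add: isCont_def)
  ultimately have "0 - 0 + ?d = 0"
    using sol g1 neq A by (intro solution_difference_order)
  then show ?thesis by simp
qed

text \<open>The second moment of the Laplace distribution is \<open>2 / l^2\<close>, so
  \<open>l\<close> is chosen to match it; the equation itself gives no information at order 2. All
  other positive orders follow from the strict inequalities.\<close>

lemma (in scales) moments_of_solution:
  assumes M: "real_distribution M" and int: "\<And>k. integrable M (\<lambda>x. x ^ k)"
    and A: "A \<subseteq> S" "card A \<ge> 2" and sol: "solution A (char M)"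
    and var: "(\<integral>x. x\<^sup>2 \<partial>M) \<noteq> 0"
  defines "l \<equiv> sqrt (2 / (\<integral>x. x\<^sup>2 \<partial>M))"
  shows "l > 0" and "(\<integral>x. x ^ p \<partial>M) = laplace_moment l p"
proof -
  interpret real_distribution M by fact
  have ne: "A \<noteq> {}" using A by auto
  have "expectation (\<lambda>x. x\<^sup>2) > 0" using var by (simp add: less_le)
  then show l: "l > 0" by (simp add: l_def)
  have l2: "expectation (\<lambda>x. x\<^sup>2) = 2 / l\<^sup>2"
    using \<open>expectation (\<lambda>x. x\<^sup>2) > 0\<close> by (simp add: l_def)
  \<comment> \<open>Order 1 is compared with the constant solution, all of whose moments of positive
    order vanish.\<close>
  have "expectation (\<lambda>x. x ^ 1) = (if (1::nat) = 0 then 1 else 0)"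
  proof (rule moment_eq_of_lower[OF M int A(1) sol solution_one[OF A(1) ne], where m = "\<lambda>j. if j = 0 then 1 else 0"])
    show "theta_power A (int 1) \<noteq> (\<Sum>k\<in>A. \<mu> k ^ 1)" using theta_power_1_less[OF A] by simp
  qed (auto simp: taylor_sum_def if_distrib prob_space simp del: space_eq_univ cong: if_cong)
  then have m1: "expectation (\<lambda>x. x) = 0" by simp
  show "expectation (\<lambda>x. x ^ p) = laplace_moment l p"
  proof (induction p rule: less_induct)
    case (less p)
    consider "p = 0" | "p = 1" | "p = 2" | "p \<ge> 3" by linarith
    then show ?case
    proof cases
      case 4
      show ?thesis
      proof (rule moment_eq_of_lower[OF M int A(1) sol solution_laplace[OF A(1) ne] _ laplace_taylor[OF l] _ less])
        have "isCont (\<lambda>t. 1 / (1 + (t / l)\<^sup>2)) 0" using l by (intro continuous_intros) auto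
        then show "((\<lambda>t. complex_of_real (1 / (1 + (t / l)\<^sup>2))) \<longlongrightarrow> 1) (at 0)"
          unfolding isCont_def by (intro tendsto_of_real[where a = 1, simplified]) simp
        show "theta_power A (int p) \<noteq> (\<Sum>k\<in>A. \<mu> k ^ p)" using theta_power_greater[OF A 4] by simp
      qed
    qed (use m1 l2 in \<open>auto simp: laplace_moment_def prob_space simp del: space_eq_univ\<close>)
  qed
qed

section \<open>The Laplace distribution and its moments\<close>

text \<open>The density at \<open>0\<close> is \<open>l\<close> instead of \<open>l / 2\<close>, since both exponential densities count the point.\<close>
definition laplace_measure :: "real \<Rightarrow> real measure" where
  "laplace_measure l = density lborel (\<lambda>x. ennreal ((exponential_density l x + exponential_density l (- x)) / 2))"

lemma has_bochner_integral_laplace_moment: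
  assumes l: "l > 0"
  shows "has_bochner_integral (laplace_measure l) (\<lambda>x. x ^ k) (laplace_moment l k)"
proof -
  \<comment> \<open>The Erlang density with parameter 0 is the exponential density.\<close>
  have 1: "has_bochner_integral lborel (\<lambda>x. exponential_density l x * x ^ k) (fact k / l ^ k)"
    using nn_integral_erlang_ith_moment[OF l, of 0 k] l
    by (intro has_bochner_integral_nn_integral) (auto simp: exponential_density_def)
  \<comment> \<open>The reflection \<open>x \<mapsto> -x\<close> as an affine substitution; it gives
    the other half of the density.\<close>
  have "has_bochner_integral lborel (\<lambda>x. exponential_density l (0 + - 1 * x) * (0 + - 1 * x) ^ k) ((fact k / l ^ k) /\<^sub>R \<bar>- 1\<bar>)"
    by (rule iffD1[OF lborel_has_bochner_integral_real_affine_iff[where c = "-1" and t = 0] 1]) simp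
  from has_bochner_integral_mult_right[OF this, of "(-1) ^ k"]
  have "has_bochner_integral lborel (\<lambda>x. (-1) ^ k * (exponential_density l (- x) * (- x) ^ k)) ((-1) ^ k * (fact k / l ^ k))"
    by simp
  moreover have "(-1) ^ k * (exponential_density l (- x) * (- x) ^ k) = exponential_density l (- x) * x ^ k" for x
    by (simp add: power_minus[of x] mult.left_commute[of "(-1) ^ k"])
  ultimately have 2: "has_bochner_integral lborel (\<lambda>x. exponential_density l (- x) * x ^ k) ((-1) ^ k * (fact k / l ^ k))"
    by simp
  from has_bochner_integral_divide[OF has_bochner_integral_add[OF 1 2], of 2]
  have "has_bochner_integral lborel (\<lambda>x. ((exponential_density l x + exponential_density l (- x)) / 2) *\<^sub>R x ^ k) (laplace_moment l k)"
    by (simp add: laplace_moment_def distrib_right add_divide_distrib mult.commute[of 2])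
  then show ?thesis
    unfolding laplace_measure_def using l
    by (intro has_bochner_integral_density) (auto intro!: AE_I2 simp: exponential_density_nonneg)
qed

lemma real_distribution_laplace:
  assumes "l > 0"
  shows "real_distribution (laplace_measure l)"
proof -
  let ?L = "laplace_measure l"
  have h: "has_bochner_integral ?L (\<lambda>x. 1 :: real) 1"
    using has_bochner_integral_laplace_moment[OF assms, of 0] by (simp add: laplace_moment_def)
  have "emeasure ?L (space ?L) = (\<integral>\<^sup>+x. ennreal 1 \<partial>?L)" by simp
  also have "\<dots> = ennreal (\<integral>x. 1 \<partial>?L)"
    using h by (intro nn_integral_eq_integral) (auto intro: integrable.intros)
  also have "\<dots> = 1" using has_bochner_integral_integral_eq[OF h] by simp
  finally have "prob_space ?L" by (rule prob_spaceI)
  then show ?thesis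
    by (auto simp: real_distribution_def real_distribution_axioms_def laplace_measure_def)
qed

lemma laplace_rv_of_distr:
  assumes l: "l > 0" and X: "X \<in> borel_measurable M" and eq: "distr M borel X = laplace_measure l"
  shows "laplace_rv M X"
  unfolding laplace_rv_def
proof (intro exI[of _ l] conjI allI l)
  fix x :: real
  let ?d = "\<lambda>y. (exponential_density l y + exponential_density l (- y)) / 2"
  interpret L: real_distribution "laplace_measure l" by (rule real_distribution_laplace[OF l])
  have "measure M {\<omega> \<in> space M. X \<omega> > x} = measure (distr M borel X) {x<..}"
    using X by (subst measure_distr) (auto intro!: arg_cong2[where f = measure])
  also have "\<dots> = (\<integral>y. indicator {x<..} y \<partial>laplace_measure l)" by (simp add: eq)
  also have "\<dots> = (\<integral>y. ?d y *\<^sub>R indicator {x<..} y \<partial>lborel)"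
    unfolding laplace_measure_def using l
    by (intro integral_density) (auto intro!: AE_I2 simp: exponential_density_nonneg)
  also have "\<dots> = (\<integral>y. l / 2 * (indicator {x<..} y *\<^sub>R exp (- l * \<bar>y\<bar>)) \<partial>lborel)"
  proof (rule integral_cong_AE)
    \<comment> \<open>The point 0, where the density has twice its usual value, is a null
      set.\<close>
    show "AE y in lborel. ?d y *\<^sub>R indicator {x<..} y = l / 2 * (indicator {x<..} y *\<^sub>R exp (- l * \<bar>y\<bar>))"
      using AE_lborel_singleton[of "0::real"]
      by eventually_elim (auto simp: exponential_density_def abs_if indicator_def mult.commute)
  qed measurable
  also have "\<dots> = l / 2 * (LINT y:{x<..}|lborel. exp (- l * \<bar>y\<bar>))"
    unfolding set_lebesgue_integral_def by simp
  finally show "measure M {\<omega> \<in> space M. X \<omega> > x} = l / 2 * (LINT y:{x<..}|lborel. exp (- l * \<bar>y\<bar>))" .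
qed

section \<open>Determinacy by moments of factorial growth\<close>

text \<open>Up to the factor \<open>\<i> ^ k\<close>, the \<open>k\<close>-th derivative of the characteristic function.\<close>
definition tilted_moment :: "real measure \<Rightarrow> nat \<Rightarrow> real \<Rightarrow> complex" where
  "tilted_moment M k t = (CLINT x|M. iexp (t * x) * complex_of_real (x ^ k))"

context real_distribution
begin

lemma integrable_tilted:
  assumes "integrable M (\<lambda>x. x ^ k)"
  shows "integrable M (\<lambda>x. iexp (t * x) * complex_of_real (x ^ k))"
proof (rule Bochner_Integration.integrable_bound)
  show "integrable M (\<lambda>x. complex_of_real (x ^ k))" using assms by (rule integrable_of_real)
qed (auto simp: norm_mult)

text \<open>The Taylor estimate for \<open>iexp (h * x)\<close> under the integral. The factor
  \<open>iexp (t * x)\<close> has norm 1, so the bound does not depend on \<open>t\<close> and the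
  expansion can be restarted at any point with the same step length.\<close>

lemma tilted_moment_taylor:
  assumes int: "\<And>k. integrable M (\<lambda>x. x ^ k)"
  shows "norm (tilted_moment M k (t + h) - (\<Sum>j\<le>n. (\<i> * complex_of_real h) ^ j / fact j * tilted_moment M (k + j) t))
    \<le> \<bar>h\<bar> ^ Suc n / fact (Suc n) * expectation (\<lambda>x. \<bar>x\<bar> ^ (k + Suc n))"
proof -
  note int' = integrable_tilted[OF int]
  let ?f = "\<lambda>x. iexp ((t + h) * x) * complex_of_real (x ^ k) - (\<Sum>j\<le>n. (\<i> * complex_of_real h) ^ j / fact j * (iexp (t * x) * complex_of_real (x ^ (k + j))))"
  have ints: "integrable M (\<lambda>x. (\<i> * complex_of_real h) ^ j / fact j * (iexp (t * x) * complex_of_real (x ^ (k + j))))" for j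
    by (rule integrable_mult_right) (rule int')
  have intf: "integrable M ?f"
    by (intro Bochner_Integration.integrable_diff Bochner_Integration.integrable_sum int' ints)
  have "tilted_moment M k (t + h) - (\<Sum>j\<le>n. (\<i> * complex_of_real h) ^ j / fact j * tilted_moment M (k + j) t) = (CLINT x|M. ?f x)"
    unfolding tilted_moment_def
    by (simp only: Bochner_Integration.integral_diff[OF int' Bochner_Integration.integrable_sum[OF ints]]
        Bochner_Integration.integral_sum[OF ints] integral_mult_right_zero)
  then have "norm (tilted_moment M k (t + h) - (\<Sum>j\<le>n. (\<i> * complex_of_real h) ^ j / fact j * tilted_moment M (k + j) t))
      \<le> expectation (\<lambda>x. norm (?f x))"
    by (simp only: integral_norm_bound)
  also have "\<dots> \<le> expectation (\<lambda>x. \<bar>h\<bar> ^ Suc n / fact (Suc n) * \<bar>x\<bar> ^ (k + Suc n))"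
  proof (rule integral_mono)
    show "integrable M (\<lambda>x. norm (?f x))"
      by (rule integrable_norm[OF intf])
    show "integrable M (\<lambda>x. \<bar>h\<bar> ^ Suc n / fact (Suc n) * \<bar>x\<bar> ^ (k + Suc n))"
      using integrable_norm[OF int[of "k + Suc n"]] by (intro integrable_mult_right) (simp only: real_norm_def power_abs)
  next
    fix x
    have ex: "iexp ((t + h) * x) = iexp (t * x) * iexp (h * x)"
      by (simp add: distrib_left distrib_right exp_add)
    have "?f x = iexp (t * x) * complex_of_real (x ^ k) * (iexp (h * x) - (\<Sum>j\<le>n. (\<i> * complex_of_real (h * x)) ^ j / fact j))"
      unfolding ex by (simp add: right_diff_distrib sum_distrib_left power_mult_distrib power_add mult_ac)
    then have "norm (?f x) = \<bar>x\<bar> ^ k * norm (iexp (h * x) - (\<Sum>j\<le>n. (\<i> * complex_of_real (h * x)) ^ j / fact j))"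
      by (simp only: norm_mult norm_exp_i_times norm_of_real power_abs mult_1_left)
    also have "\<dots> \<le> \<bar>x\<bar> ^ k * (\<bar>h * x\<bar> ^ Suc n / fact (Suc n))"
      using iexp_approx1[of "h * x" n] by (intro mult_left_mono) auto
    also have "\<dots> = \<bar>h\<bar> ^ Suc n / fact (Suc n) * \<bar>x\<bar> ^ (k + Suc n)"
      by (simp add: abs_mult power_mult_distrib power_add del: fact_Suc)
    finally show "norm (?f x) \<le> \<bar>h\<bar> ^ Suc n / fact (Suc n) * \<bar>x\<bar> ^ (k + Suc n)" .
  qed
  finally show ?thesis by simp
qed

end

lemma fact_add_le: "fact (k + q) \<le> (2 ^ (k + q) * (fact k * fact q) :: real)"
proof -
  have "real ((k + q) choose k) \<le> 2 ^ (k + q)"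
    using binomial_le_pow2[of "k + q" k] by (metis of_nat_le_iff of_nat_numeral of_nat_power)
  moreover have "(fact (k + q) :: real) = real ((k + q) choose k) * (fact k * fact q)"
    by (simp add: binomial_fact)
  ultimately show ?thesis by (simp add: mult_right_mono)
qed

text \<open>Both Taylor sums at \<open>t\<close> agree, so only the two remainders count. The moment
  bound and \<open>fact_add_le\<close> reduce them to a multiple of
  \<open>(2 * \<bar>h\<bar> / r) ^ q\<close>, and \<open>\<bar>h\<bar> \<le> r / 4\<close> makes
  this geometric with ratio at most 1/2.\<close>

lemma tilted_moments_step:
  assumes M: "real_distribution M" "real_distribution N"
    and int: "\<And>k. integrable M (\<lambda>x. x ^ k)" "\<And>k. integrable N (\<lambda>x. x ^ k)"
    and bd: "\<And>k. (\<integral>x. x ^ (2 * k) \<partial>M) \<le> C * fact (2 * k) / r ^ (2 * k)"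
      "\<And>k. (\<integral>x. x ^ (2 * k) \<partial>N) \<le> C * fact (2 * k) / r ^ (2 * k)"
    and r: "r > 0" and h: "\<bar>h\<bar> \<le> r / 4"
    and eq: "\<And>k. tilted_moment M k t = tilted_moment N k t"
  shows "tilted_moment M k (t + h) = tilted_moment N k (t + h)"
proof -
  interpret M: real_distribution M by (rule M)
  interpret N: real_distribution N by (rule M)
  have "1 \<le> C" using bd(1)[of 0] by (simp add: M.prob_space del: M.space_eq_univ)
  define K where "K = C * fact k * (2 / r) ^ k"
  have rem: "\<bar>h\<bar> ^ q / fact q * (\<integral>x. \<bar>x\<bar> ^ (k + q) \<partial>P) \<le> K * (1 / 2) ^ q"
    if P: "\<And>k. (\<integral>x. x ^ (2 * k) \<partial>P) \<le> C * fact (2 * k) / r ^ (2 * k)" and q: "even (k + q)" for P q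
  proof -
    obtain m where m: "k + q = 2 * m" using q by (elim evenE)
    have "(\<integral>x. \<bar>x\<bar> ^ (k + q) \<partial>P) \<le> C * fact (k + q) / r ^ (k + q)"
      using P[of m] unfolding m by (simp add: power_even_abs)
    also have "\<dots> \<le> C * (2 ^ (k + q) * (fact k * fact q)) / r ^ (k + q)"
      using \<open>1 \<le> C\<close> r fact_add_le by (intro divide_right_mono mult_left_mono) auto
    finally have "\<bar>h\<bar> ^ q / fact q * (\<integral>x. \<bar>x\<bar> ^ (k + q) \<partial>P)
        \<le> \<bar>h\<bar> ^ q / fact q * (C * (2 ^ (k + q) * (fact k * fact q)) / r ^ (k + q))"
      by (intro mult_left_mono) auto
    also have "\<dots> = K * (2 * \<bar>h\<bar> / r) ^ q"
      unfolding K_def by (simp add: power_add power_mult_distrib power_divide)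
    also have "\<dots> \<le> K * (1 / 2) ^ q"
      using h r \<open>1 \<le> C\<close> by (intro mult_left_mono power_mono) (auto simp: K_def field_simps)
    finally show ?thesis .
  qed
  let ?d = "norm (tilted_moment M k (t + h) - tilted_moment N k (t + h))"
  have le: "?d \<le> 2 * K * (1 / 2) ^ n" for n
  proof -
    \<comment> \<open>Then \<open>k + Suc p\<close> is even, as the bound on even moments requires,
      and \<open>Suc p\<close> is at least \<open>n\<close>.\<close>
    define p where "p = k + 2 * n + 1"
    let ?T = "\<lambda>P. (\<Sum>j\<le>p. (\<i> * complex_of_real h) ^ j / fact j * tilted_moment P (k + j) t)"
    have ev: "even (k + Suc p)" by (simp add: p_def)
    have "?T M = ?T N" by (simp only: eq)
    then have "tilted_moment M k (t + h) - tilted_moment N k (t + h)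
        = (tilted_moment M k (t + h) - ?T M) - (tilted_moment N k (t + h) - ?T N)"
      by (simp only: diff_diff_eq2 diff_add_cancel)
    then have "?d \<le> norm (tilted_moment M k (t + h) - ?T M) + norm (tilted_moment N k (t + h) - ?T N)"
      by (simp only: norm_triangle_ineq4)
    also have "\<dots> \<le> K * (1 / 2) ^ Suc p + K * (1 / 2) ^ Suc p"
      by (intro add_mono order_trans[OF M.tilted_moment_taylor[OF int(1)] rem[OF bd(1) ev]]
          order_trans[OF N.tilted_moment_taylor[OF int(2)] rem[OF bd(2) ev]])
    also have "\<dots> = 2 * K * (1 / 2) ^ Suc p" by simp
    also have "\<dots> \<le> 2 * K * (1 / 2) ^ n"
      using \<open>1 \<le> C\<close> r by (intro mult_left_mono power_decreasing) (auto simp: K_def p_def)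
    finally show ?thesis .
  qed
  have "(\<lambda>n. 2 * K * (1 / 2) ^ n) \<longlonglongrightarrow> 2 * K * 0"
    by (intro tendsto_mult tendsto_const LIMSEQ_power_zero) simp
  then have "(\<lambda>n. 2 * K * (1 / 2) ^ n) \<longlonglongrightarrow> 0" by simp
  then have "?d \<le> 0" by (rule LIMSEQ_le_const) (use le in blast)
  then show ?thesis by simp
qed

text \<open>At 0 all tilted moments agree, being the moments up to a common factor. Steps of length
  at most \<open>r / 4\<close> carry the agreement to every real \<open>t\<close>; order 0 is the
  characteristic function, and Levy's uniqueness theorem applies.\<close>

lemma moment_determinacy:
  assumes M: "real_distribution M" "real_distribution N"
    and int: "\<And>k. integrable M (\<lambda>x. x ^ k)" "\<And>k. integrable N (\<lambda>x. x ^ k)"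
    and eq: "\<And>k. (\<integral>x. x ^ k \<partial>M) = (\<integral>x. x ^ k \<partial>N)"
    and r: "r > 0" and bd: "\<And>k. (\<integral>x. x ^ (2 * k) \<partial>M) \<le> C * fact (2 * k) / r ^ (2 * k)"
  shows "M = N"
proof -
  have bdN: "(\<integral>x. x ^ (2 * k) \<partial>N) \<le> C * fact (2 * k) / r ^ (2 * k)" for k
    using bd[of k] by (simp add: eq)
  have *: "\<bar>t\<bar> \<le> real n * (r / 4) \<Longrightarrow> tilted_moment M k t = tilted_moment N k t" for t n k
  proof (induction n arbitrary: t k)
    case 0
    then show ?case using eq[of k] by (simp add: tilted_moment_def flip: of_real_power)
  next
    case (Suc n)
    \<comment> \<open>Split the way from 0 to \<open>t\<close> into \<open>Suc n\<close> equal
      steps; the first \<open>n\<close> are covered by the induction hypothesis.\<close>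
    have le: "\<bar>t / real (Suc n)\<bar> \<le> r / 4"
      using Suc.prems by (simp add: abs_divide pos_divide_le_eq mult.commute del: of_nat_Suc)
    have "\<bar>real n * (t / real (Suc n))\<bar> \<le> real n * (r / 4)"
      unfolding abs_mult using le by (intro mult_mono) auto
    from tilted_moments_step[OF M int bd bdN r le Suc.IH[OF this]]
    have "tilted_moment M k (real n * (t / real (Suc n)) + t / real (Suc n))
        = tilted_moment N k (real n * (t / real (Suc n)) + t / real (Suc n))" .
    moreover have "real n * (t / real (Suc n)) + t / real (Suc n) = t"
    proof -
      have *: "real n * u + u = real (Suc n) * u" for u by (simp add: algebra_simps)
      show ?thesis unfolding * by (simp del: of_nat_Suc)
    qed
    ultimately show ?case by simp
  qed
  have "char M t = char N t" for t
  proof -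
    obtain n :: nat where "\<bar>t\<bar> / (r / 4) < real n" using reals_Archimedean2 by blast
    then have "\<bar>t\<bar> \<le> real n * (r / 4)" using r by (simp add: field_simps)
    from *[OF this, of 0] show ?thesis by (simp add: tilted_moment_def char_def)
  qed
  then show ?thesis using Levy_uniqueness[OF M] by blast
qed

theorem theorem2:
  fixes M :: "'a measure" and X :: "'a \<Rightarrow> real" and n :: nat and \<mu> :: "nat \<Rightarrow> real"
  assumes "prob_space M"
    and "X \<in> borel_measurable M"
    and "n \<ge> 2"
    and "inj_on \<mu> {1..n}"
    and "\<forall>k\<in>{1..n}. \<mu> k > 0"
    and "infinitely_differentiable_at (char (distr M borel X)) 0"
    and "\<forall>t::real. (\<Prod>k\<in>{1..n}. char (distr M borel X) (\<mu> k * t)) =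
           (\<Sum>k\<in>{1..n}. complex_of_real (theta_coef n \<mu> k) * char (distr M borel X) (\<mu> k * t))"
  shows "measure M {\<omega> \<in> space M. X \<omega> = 0} = 1 \<or> laplace_rv M X"
proof -
  interpret P: prob_space M by fact
  let ?D = "distr M borel X"
  interpret D: real_distribution ?D
    by (rule P.real_distribution_distr[OF assms(2)])
  interpret scales \<mu> "{1..n}"
    by (rule scales.intro[OF finite_atLeastAtMost assms(4) bspec[OF assms(5)]])
  have int: "integrable ?D (\<lambda>x. x ^ k)" for k
    by (rule D.integrable_power_if_even[OF D.integrable_even_power[OF assms(6)]])
  have sol: "solution {1..n} (char ?D)"
    using assms(7) unfolding solution_def theta_def theta_coef_def .
  show ?thesis
  \<comment> \<open>A zero second moment forces \<open>X = 0\<close> almost surely; otherwise it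
    fixes the scale of the Laplace distribution.\<close>
  proof (cases "(\<integral>x. x\<^sup>2 \<partial>?D) = 0")
    case True
    then have "AE x in ?D. x\<^sup>2 = 0"
      using integral_nonneg_eq_0_iff_AE[OF int[of 2]] by simp
    then have "AE \<omega> in M. (X \<omega>)\<^sup>2 = 0"
      by (rule AE_distrD[OF assms(2)])
    then have "AE \<omega> in M. X \<omega> = 0" by simp
    then have "measure M {\<omega> \<in> space M. X \<omega> = 0} = 1"
      using assms(2) by (subst P.prob_Collect_eq_1) auto
    then show ?thesis ..
  next
    case False
    define l where "l = sqrt (2 / (\<integral>x. x\<^sup>2 \<partial>?D))"
    have l: "l > 0" and mom: "(\<integral>x. x ^ p \<partial>?D) = laplace_moment l p" for p
      unfolding l_def using assms(3) False
      by (intro moments_of_solution[OF D.real_distribution_axioms int order_refl _ sol]; simp)+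
    note L = has_bochner_integral_laplace_moment[OF l]
    have "?D = laplace_measure l"
    \<comment> \<open>The even Laplace moments are exactly
      \<open>fact (2 * k) / l ^ (2 * k)\<close>, so the growth bound holds with \<open>C = 1\<close>
      and \<open>r = l\<close>.\<close>
    proof (rule moment_determinacy[OF D.real_distribution_axioms real_distribution_laplace[OF l] int _ _ l, where C = 1])
      show "integrable (laplace_measure l) (\<lambda>x. x ^ k)" for k
        using L by (rule integrable.intros)
      show "(\<integral>x. x ^ k \<partial>?D) = (\<integral>x. x ^ k \<partial>laplace_measure l)" for k
        using has_bochner_integral_integral_eq[OF L] mom by simp
      show "(\<integral>x. x ^ (2 * k) \<partial>?D) \<le> 1 * fact (2 * k) / l ^ (2 * k)" for k
        unfolding mom by (simp add: laplace_moment_def)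
    qed
    then show ?thesis using laplace_rv_of_distr[OF l assms(2)] by blast
  qed
qed

end
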